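(* Let $X$ be a real Banach space with norm $\|\cdot\|_X$, let $F_k:X\to\mathcal{I}$ be $\preccurlyeq_{CW}$-lsc for all $k=1,\dots,m$, and let $F(u):=(F_1(u),\dots,F_m(u))$. Let $\epsilon>0$, $\varepsilon:=(\epsilon,\dots,\epsilon)\in\mathbb{R}^m_+$, $\varepsilon':=(\sqrt{\epsilon},\dots,\sqrt{\epsilon})\in\mathbb{R}^m_+$, and let $x_0\in M(F,X,\varepsilon)$. Then there is a point $\overline{u}\in X$ such that (a) $\overline{u}\in M(F,X,\varepsilon)$; (b) $\|x_0-\overline{u}\|_X\leq\sqrt{\epsilon}$; (c) $\overline{u}\in QM(F,X,\varepsilon')$.
   Context: $\mathcal{I}$ is the set of all compact intervals $[\underline q,\overline q]$ with $\underline q\le\overline q$ real. For $Q=[\underline q,\overline q]\in\mathcal I$ put $q^c=\frac{\underline q+\overline q}{2}$ and $q^w=\frac{\overline q-\underline q}{2}$. Addition: $[\underline q,\overline q]+[\underline r,\overline r]=[\underline q+\underline r,\overline q+\overline r]$. Order: $Q\prec_{CW}R$ iff $q^c<r^c$ and $q^w<r^w$. $\mathbb{R}^m_+$ is the nonnegative orthant of $\mathbb{R}^m$. For an interval-valued function $f=[\underline f,\overline f]$ on $X$ write $f^c=\frac{\underline f+\overline f}{2}$, $f^w=\frac{\overline f-\underline f}{2}$; $f$ is $\preccurlyeq_{CW}$-lsc if the real-valued functions $f^c$ and $f^w$ are both lower semicontinuous on $X$. For $\eta=(\eta_1,\dots,\eta_m)\in\mathbb{R}^m_+$: $M(F,X,\eta)$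 is the set of $z_0\in X$ for which there is no $z\in X$ with $F_k(z)+[0,\eta_k]\prec_{CW}F_k(z_0)$ for all $k$; $QM(F,X,\eta)$ is the set of $z_0\in X$ for which there is no $z\in X$ with $F_k(z)+[0,\eta_k\|z-z_0\|_X]\prec_{CW}F_k(z_0)$ for all $k$. *)

theory Defs
  imports "HOL-Analysis.Analysis" "HOL-Library.Interval"
begin

text \<open>
  Compact intervals are elements of \<^typ>\<open>real interval\<close>. The constructor \<^const>\<open>Interval\<close> takes a
  pair of endpoints and is meaningful only if they are ordered.
\<close>

lemma lower_Interval [simp]: "a \<le> b \<Longrightarrow> lower (Interval (a, b)) = (a::real)"
  by (simp add: lower.rep_eq Interval_inverse)

lemma upper_Interval [simp]: "a \<le> b \<Longrightarrow> upper (Interval (a, b)) = (b::real)"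
  by (simp add: upper.rep_eq Interval_inverse)

definition center :: "real interval \<Rightarrow> real"
  where "center Q = (lower Q + upper Q) / 2"

text \<open>Half of the library's \<^const>\<open>width\<close>.\<close>

definition halfwidth :: "real interval \<Rightarrow> real"
  where "halfwidth Q = (upper Q - lower Q) / 2"

text \<open>
  The order instance of the interval type is inclusion, so the center-width order gets its own symbol.
\<close>

definition cw_less :: "real interval \<Rightarrow> real interval \<Rightarrow> bool"  (infix \<open>\<prec>\<^sub>C\<^sub>W\<close> 50)
  where "Q \<prec>\<^sub>C\<^sub>W R \<longleftrightarrow> center Q < center R \<and> halfwidth Q < halfwidth R"

definition lsc_on :: "'a::topological_space set \<Rightarrow> ('a \<Rightarrow> real) \<Rightarrow> bool"
  where "lsc_on X f \<longleftrightarrow> (\<forall>x\<in>X. \<forall>y. y < f x \<longrightarrow> (\<forall>\<^sub>F z in at x within X. y < f z))"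

definition cw_lsc_on :: "'a::topological_space set \<Rightarrow> ('a \<Rightarrow> real interval) \<Rightarrow> bool"
  where "cw_lsc_on X f \<longleftrightarrow> lsc_on X (\<lambda>x. center (f x)) \<and> lsc_on X (\<lambda>x. halfwidth (f x))"

text \<open>
  The index set of the components is the finite type \<open>'m\<close>, that is, \<open>m = CARD('m)\<close>. In the next two
  definitions \<open>\<eta>\<close> ranges over the nonnegative orthant, so that \<open>[0, \<eta>\<^sub>k]\<close> is a proper interval.
\<close>

definition M :: "('a \<Rightarrow> real interval ^ 'm) \<Rightarrow> 'a set \<Rightarrow> real ^ 'm \<Rightarrow> 'a set"
  where "M F X \<eta> = {z0 \<in> X. \<not> (\<exists>z\<in>X. \<forall>k. F z $ k + Interval (0, \<eta> $ k) \<prec>\<^sub>C\<^sub>W F z0 $ k)}"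

definition QM :: "('a::real_normed_vector \<Rightarrow> real interval ^ 'm) \<Rightarrow> 'a set \<Rightarrow> real ^ 'm \<Rightarrow> 'a set"
  where "QM F X \<eta> =
    {z0 \<in> X. \<not> (\<exists>z\<in>X. \<forall>k. F z $ k + Interval (0, \<eta> $ k * norm (z - z0)) \<prec>\<^sub>C\<^sub>W F z0 $ k)}"

end

theory Submission
  imports Defs
begin

text \<open>
  Adding \<open>[0, e]\<close> to an interval raises its center and its half-width by \<open>e / 2\<close>, so the assertion
  concerns the \<open>2m\<close> real functions \<open>f\<^sub>j\<close> given by the centers and half-widths of the \<open>F\<^sub>k\<close>. No
  component is assumed bounded below, but \<open>x\<^sub>0 \<in> M(F, X, \<epsilon>)\<close> says exactly that the lower semicontinuous
  function \<open>\<phi>(z) = max\<^sub>j (f\<^sub>j(z) - f\<^sub>j(x\<^sub>0))\<close> is bounded below by \<open>-\<epsilon> / 2\<close>. Since \<open>\<phi>(x\<^sub>0) = 0\<close>,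
  Ekeland's variational principle for \<open>\<phi>\<close> with slope \<open>\<surd>\<epsilon> / 2\<close> yields the point.
\<close>

lemma cw_less_plus_Interval_iff:
  assumes "0 \<le> e"
  shows "Q + Interval (0, e) \<prec>\<^sub>C\<^sub>W R \<longleftrightarrow>
    center Q + e / 2 < center R \<and> halfwidth Q + e / 2 < halfwidth R"
  using assms by (simp add: cw_less_def center_def halfwidth_def field_simps)

lemma lsc_on_diff_const:
  assumes "lsc_on X f"
  shows "lsc_on X (\<lambda>x. f x - c)"
  using assms by (auto simp: lsc_on_def less_diff_eq)

lemma lsc_on_max:
  assumes "lsc_on X f" "lsc_on X g"
  shows "lsc_on X (\<lambda>x. max (f x) (g x))"
  using assms unfolding lsc_on_def less_max_iff_disj by (blast intro: eventually_mono)

lemma lsc_on_Max: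
  assumes "finite I" "I \<noteq> {}" "\<And>i. i \<in> I \<Longrightarrow> lsc_on X (f i)"
  shows "lsc_on X (\<lambda>x. Max ((\<lambda>i. f i x) ` I))"
  using assms unfolding lsc_on_def by (simp add: Max_gr_iff) (blast intro: eventually_mono)

text \<open>Otherwise some \<open>y\<close> strictly between \<open>h u\<close> and
  \<open>f u\<close> would eventually separate the values along the sequence in the wrong order.
  This makes sublevel sets of \<open>f\<close> plus a continuous penalty closed.\<close>

lemma lsc_on_le_lim:
  fixes f h :: "'a::t2_space \<Rightarrow> real"
  assumes lsc: "lsc_on UNIV f" and lim: "X \<longlonglongrightarrow> u" and h: "isCont h u"
    and le: "\<forall>\<^sub>F n in sequentially. f (X n) \<le> h (X n)"
  shows "f u \<le> h u"
proof (rule ccontr)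
  assume "\<not> f u \<le> h u"
  then obtain y where y: "h u < y" "y < f u"
    using dense[of "h u" "f u"] by auto
  have "\<forall>\<^sub>F z in at u. y < f z"
    using lsc y by (auto simp: lsc_on_def)
  \<comment> \<open>The punctured filter omits \<open>u\<close>; \<open>y < f u\<close> fills the
    gap, as the sequence may hit its limit.\<close>
  with y have "\<forall>\<^sub>F z in nhds u. y < f z"
    by (simp add: eventually_nhds_conv_at)
  then have "\<forall>\<^sub>F n in sequentially. y < f (X n)"
    using lim by (rule eventually_compose_filterlim)
  moreover have "\<forall>\<^sub>F n in sequentially. h (X n) < y"
    using isCont_tendsto_compose[OF h lim] y by (simp add: order_tendsto_iff)
  ultimately have "\<forall>\<^sub>F n in sequentially. False"
    using le by eventually_elim auto
  then show False by simp
qed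

text \<open>\<open>z \<in> S x\<close> is a partial order along which \<open>f\<close> drops at rate
  at least \<open>r\<close>. Near-minimizers chosen in successive lower sections converge, and their
  limit is a minimal element.\<close>

theorem ekeland_variational_principle:
  fixes f :: "'a::complete_space \<Rightarrow> real"
  assumes lsc: "lsc_on UNIV f" and bdd: "\<And>z. b \<le> f z" and r: "0 < r"
  obtains u where "f u + r * dist u x0 \<le> f x0" "\<And>z. z \<noteq> u \<Longrightarrow> f u < f z + r * dist z u"
proof -
  define S where "S x = {z. f z + r * dist z x \<le> f x}" for x
  have S_refl: "x \<in> S x" for x
    by (simp add: S_def)
  have S_trans: "z \<in> S x" if "z \<in> S y" "y \<in> S x" for x y z
  proof -
    have "r * dist z x \<le> r * dist z y + r * dist y x"
      using r dist_triangle[of z x y] by (simp flip: distrib_left)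
    with that show ?thesis by (simp add: S_def)
  qed
  have bdd_S: "bdd_below (f ` S x)" for x
    using bdd by (auto intro!: bdd_belowI2)
  \<comment> \<open>The infimum over a section need not be attained, so a tolerance tending to 0 is
    allowed.\<close>
  have ex_next: "\<exists>y. y \<in> S x \<and> (\<forall>z \<in> S x. f y < f z + (1/2) ^ n)" for x and n :: nat
  proof -
    have "\<exists>v \<in> f ` S x. v < Inf (f ` S x) + (1/2) ^ n"
      using S_refl[of x] bdd_S by (subst cInf_less_iff[symmetric]) auto
    then obtain y where y: "y \<in> S x" "f y < Inf (f ` S x) + (1/2) ^ n"
      by auto
    have "f y < f z + (1/2) ^ n" if "z \<in> S x" for z
      using y(2) cInf_lower[OF imageI[OF that] bdd_S] by linarith
    with y(1) show ?thesis by blast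
  qed
  define next_pt where "next_pt n x = (SOME y. y \<in> S x \<and> (\<forall>z \<in> S x. f y < f z + (1/2) ^ n))"
    for n x
  have next_pt: "next_pt n x \<in> S x" "z \<in> S x \<Longrightarrow> f (next_pt n x) < f z + (1/2) ^ n" for n x z
    using someI_ex[OF ex_next[of x n]] by (auto simp: next_pt_def)
  define X where "X = rec_nat x0 next_pt"
  have X_0: "X 0 = x0" and X_Suc: "X (Suc n) = next_pt n (X n)" for n
    by (simp_all add: X_def)
  have X_S: "X n \<in> S (X m)" if "m \<le> n" for m n
    using that by (induction rule: dec_induct) (auto simp: X_Suc intro: S_refl S_trans next_pt)
  have f_mono: "f (X n) \<le> f (X m)" if "m \<le> n" for m n
    using X_S[OF that] r zero_le_dist[of "X n" "X m"]
    by (smt (verit) S_def mem_Collect_eq mult_nonneg_nonneg)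
  have "convergent (\<lambda>n. f (X n))"
    using f_mono bdd by (intro Bseq_monoseq_convergent decseq_bounded)
      (auto simp: decseq_def monoseq_iff)
  then have Cauchy_f: "Cauchy (\<lambda>n. f (X n))"
    by (rule convergent_Cauchy)
  have "Cauchy X"
  proof (rule CauchyI')
    fix e :: real assume "0 < e"
    with r have "0 < r * e" by simp
    then obtain N where N: "\<And>m n. N \<le> m \<Longrightarrow> N \<le> n \<Longrightarrow> dist (f (X m)) (f (X n)) < r * e"
      using Cauchy_f unfolding Cauchy_def by blast
    have "dist (X m) (X n) < e" if "N \<le> m" "m < n" for m n
    proof -
      \<comment> \<open>Distances are controlled by the drop of \<open>f\<close>, so the Cauchy
        property passes from the values to the points.\<close>
      have "r * dist (X m) (X n) \<le> f (X m) - f (X n)"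
        using X_S[of m n] that by (simp add: S_def dist_commute)
      also have "\<dots> < r * e"
        using N[of m n] that by (simp add: dist_real_def)
      finally show ?thesis using r by simp
    qed
    then show "\<exists>N. \<forall>m\<ge>N. \<forall>n>m. dist (X m) (X n) < e" by blast
  qed
  then obtain u where lim: "X \<longlonglongrightarrow> u"
    using Cauchy_convergent convergent_def by blast
  have u: "u \<in> S (X n)" for n
  proof -
    \<comment> \<open>The tail of \<open>X\<close> lies in \<open>S (X n)\<close>, and lower
      semicontinuity keeps the limit there.\<close>
    have "\<forall>\<^sub>F m in sequentially. f (X m) \<le> f (X n) - r * dist (X m) (X n)"
      using eventually_ge_at_top[of n] by eventually_elim (use X_S in \<open>force simp: S_def\<close>)
    then have "f u \<le> f (X n) - r * dist u (X n)"
      by (intro lsc_on_le_lim[OF lsc lim]) (auto intro!: continuous_intros)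
    then show ?thesis by (simp add: S_def)
  qed
  have "z = u" if z: "z \<in> S u" for z
  proof -
    \<comment> \<open>Membership in \<open>S (X (Suc n))\<close> bounds the left side by
      \<open>f (X (Suc n)) - f z\<close>; near-minimality over \<open>S (X n)\<close>, which also
      contains \<open>z\<close>, bounds that difference by the tolerance.\<close>
    have "r * dist (X (Suc n)) z \<le> (1/2) ^ n" for n
    proof -
      have "z \<in> S (X n)" "z \<in> S (X (Suc n))"
        using z u S_trans by blast+
      then show ?thesis
        using next_pt(2)[of z "X n" n] by (simp add: S_def X_Suc dist_commute)
    qed
    moreover have "(\<lambda>n. r * dist (X (Suc n)) z) \<longlonglongrightarrow> r * dist u z"
      by (intro tendsto_intros LIMSEQ_Suc lim)
    moreover have "(\<lambda>n. (1/2) ^ n :: real) \<longlonglongrightarrow> 0"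
      by (intro LIMSEQ_power_zero) simp
    ultimately have "r * dist u z \<le> 0"
      by (blast intro: LIMSEQ_le)
    with r show ?thesis by (simp add: mult_le_0_iff)
  qed
  then have "f u < f z + r * dist z u" if "z \<noteq> u" for z
    using that by (force simp: S_def)
  moreover have "f u + r * dist u x0 \<le> f x0"
    using u[of 0] by (simp add: S_def X_0)
  ultimately show thesis by (rule that[rotated])
qed

theorem proposition3p2:
  fixes F :: "'a::banach \<Rightarrow> real interval ^ 'm::finite"
    and \<epsilon> :: real and x0 :: 'a
  assumes "\<forall>k. cw_lsc_on UNIV (\<lambda>u. F u $ k)"
    and "\<epsilon> > 0"
    and "x0 \<in> M F UNIV (\<chi> k. \<epsilon>)"
  shows "\<exists>u. u \<in> M F UNIV (\<chi> k. \<epsilon>)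
           \<and> norm (x0 - u) \<le> sqrt \<epsilon>
           \<and> u \<in> QM F UNIV (\<chi> k. sqrt \<epsilon>)"
proof -
  define c where "c k z = center (F z $ k)" for k z
  define w where "w k z = halfwidth (F z $ k)" for k z
  define g where "g k z = max (c k z - c k x0) (w k z - w k x0)" for k z
  define \<phi> where "\<phi> z = Max (range (\<lambda>k. g k z))" for z
  have M_iff: "z0 \<in> M F UNIV (\<chi> k. \<epsilon>) \<longleftrightarrow>
      (\<nexists>z. \<forall>k. c k z + \<epsilon> / 2 < c k z0 \<and> w k z + \<epsilon> / 2 < w k z0)" for z0
    using \<open>\<epsilon> > 0\<close> by (simp add: M_def cw_less_plus_Interval_iff c_def w_def)
  have less_iff: "\<phi> z < t \<longleftrightarrow> (\<forall>k. c k z - c k x0 < t \<and> w k z - w k x0 < t)" for z t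
    by (simp add: \<phi>_def g_def)
  have ge: "c k z - c k x0 \<le> \<phi> z" "w k z - w k x0 \<le> \<phi> z" for k z
    using less_iff[of z "\<phi> z"] Max_ge[of "range (\<lambda>k. g k z)" "g k z"]
    by (auto simp: \<phi>_def g_def)
  have "lsc_on UNIV \<phi>"
    using assms(1) unfolding \<phi>_def g_def c_def w_def cw_lsc_on_def
    by (intro lsc_on_Max lsc_on_max lsc_on_diff_const) auto
  moreover have "- \<epsilon> / 2 \<le> \<phi> z" for z
  proof (rule ccontr)
    assume "\<not> - \<epsilon> / 2 \<le> \<phi> z"
    then have "\<phi> z < - \<epsilon> / 2" by simp
    then have "\<forall>k. c k z + \<epsilon> / 2 < c k x0 \<and> w k z + \<epsilon> / 2 < w k x0"
      unfolding less_iff by (simp add: algebra_simps)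
    with assms(3) show False unfolding M_iff by blast
  qed
  moreover have "0 < sqrt \<epsilon> / 2" using \<open>\<epsilon> > 0\<close> by simp
  ultimately obtain u where u: "\<phi> u + sqrt \<epsilon> / 2 * dist u x0 \<le> \<phi> x0"
    "\<And>z. z \<noteq> u \<Longrightarrow> \<phi> u < \<phi> z + sqrt \<epsilon> / 2 * dist z u" and low: "- \<epsilon> / 2 \<le> \<phi> u"
    using ekeland_variational_principle[of \<phi> "- \<epsilon> / 2" "sqrt \<epsilon> / 2" x0] by metis
  have \<phi>0: "\<phi> x0 = 0"
    by (simp add: \<phi>_def g_def)
  have "\<phi> u \<le> 0"
    using u(1) \<phi>0 \<open>\<epsilon> > 0\<close> zero_le_dist[of u x0]
    by (smt (verit) mult_nonneg_nonneg real_sqrt_gt_zero divide_nonneg_pos)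
  then have u_le: "c k u \<le> c k x0" "w k u \<le> w k x0" for k
    using ge[of k u] by linarith+
  \<comment> \<open>By \<open>u_le\<close>, a point beating \<open>u\<close> by the margin in all
    components would also beat \<open>x0\<close>.\<close>
  have "u \<in> M F UNIV (\<chi> k. \<epsilon>)"
    using assms(3) unfolding M_iff by (meson less_le_trans u_le)
  moreover have "norm (x0 - u) \<le> sqrt \<epsilon>"
  proof -
    \<comment> \<open>From 0 at \<open>x0\<close>, \<open>\<phi>\<close> can fall by at most
      \<open>\<epsilon> / 2\<close>, which at slope \<open>sqrt \<epsilon> / 2\<close> allows
      distance \<open>sqrt \<epsilon>\<close>.\<close>
    have "sqrt \<epsilon> * dist u x0 \<le> \<epsilon>"
      using u(1) \<phi>0 low by simp
    also have "\<epsilon> = sqrt \<epsilon> * sqrt \<epsilon>" using \<open>\<epsilon> > 0\<close> by simp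
    finally show ?thesis
      using \<open>\<epsilon> > 0\<close> by (simp add: dist_norm norm_minus_commute del: real_sqrt_mult_self)
  qed
  moreover have "u \<in> QM F UNIV (\<chi> k. sqrt \<epsilon>)"
  proof -
    have False if less: "\<forall>k. F z $ k + Interval (0, sqrt \<epsilon> * norm (z - u)) \<prec>\<^sub>C\<^sub>W F u $ k" for z
    proof -
      \<comment> \<open>This shift of center and half-width is exactly the Ekeland penalty between
        \<open>z\<close> and \<open>u\<close>.\<close>
      define d where "d = sqrt \<epsilon> * norm (z - u) / 2"
      have d: "c k z + d < c k u" "w k z + d < w k u" for k
        using less \<open>\<epsilon> > 0\<close> by (simp_all add: cw_less_plus_Interval_iff c_def w_def d_def)
      have "\<phi> z < \<phi> u - d"
        unfolding less_iff using ge[of _ u] d by (smt (verit))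
      \<comment> \<open>For \<open>z = u\<close> the shift vanishes and \<open>d\<close> would read
        \<open>c k u < c k u\<close>.\<close>
      moreover have "z \<noteq> u"
        using d by (force simp: d_def)
      ultimately show False
        using u(2)[of z] by (simp add: d_def dist_norm)
    qed
    then show ?thesis by (auto simp: QM_def)
  qed
  ultimately show ?thesis by blast
qed

end
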